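(* Let $n,m\ge1$ and $1\le k\le n$ be integers and $\varepsilon\ge0$. If a randomized selection rule $M$ (selecting $k$ of $n$ candidates from review matrices in $[0,1]^{n\times m}$) satisfies $\varepsilon$-metric differential privacy with respect to $\|\cdot\|_{1,1}$, then its induced marginal selection probabilities $p$ are $L$-smooth for some $L\le\varepsilon k$.
   Context: A randomized selection rule $M$ maps each review matrix $X\in[0,1]^{n\times m}$ to a probability distribution on the size-$k$ subsets of $[n]=\{1,\dots,n\}$. Its marginal selection probabilities are $p_i(X)=\Pr[i\in M(X)]$. Write $\|A\|_{1,1}=\sum_{i,j}|A_{i,j}|$. $M$ satisfies $\varepsilon$-metric differential privacy with respect to $\|\cdot\|_{1,1}$ if for all $X,X'\in[0,1]^{n\times m}$ and every size-$k$ subset $S\subseteq[n]$, $$\Pr[M(X)=S]\le\exp\left(\varepsilon\|X-X'\|_{1,1}\right)\Pr[M(X')=S].$$ The marginals are $L$-smooth if $\|p(X)-p(X')\|_1\le L\|X-X'\|_{1,1}$ for all $X,X'\in[0,1]^{n\times m}$. *)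

theory Defs
  imports "HOL-Probability.Probability"
begin

text \<open>
  The candidates are the elements of the finite index type \<open>'n\<close> and the columns of a
  review matrix are indexed by \<open>'m\<close>, so that \<open>n = CARD('n)\<close> and \<open>m = CARD('m)\<close>; both are
  automatically at least 1.
\<close>

definition review_matrices :: "(real ^ 'm ^ 'n) set" where
  "review_matrices = {X. \<forall>i j. 0 \<le> X $ i $ j \<and> X $ i $ j \<le> 1}"

definition norm11 :: "real ^ 'm ^ 'n \<Rightarrow> real" where
  "norm11 A = (\<Sum>i\<in>UNIV. \<Sum>j\<in>UNIV. \<bar>A $ i $ j\<bar>)"

definition norm1 :: "real ^ 'n \<Rightarrow> real" where
  "norm1 v = (\<Sum>i\<in>UNIV. \<bar>v $ i\<bar>)"

text \<open>
  A rule is a total function on matrices, but its values outside \<open>review_matrices\<close> are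
  irrelevant: all properties below only concern matrices with entries in the unit interval.
\<close>

definition selection_rule :: "nat \<Rightarrow> (real ^ 'm ^ 'n \<Rightarrow> 'n set pmf) \<Rightarrow> bool" where
  "selection_rule k M \<longleftrightarrow> (\<forall>X\<in>review_matrices. set_pmf (M X) \<subseteq> {S. card S = k})"

definition marginals :: "(real ^ 'm ^ 'n \<Rightarrow> 'n set pmf) \<Rightarrow> real ^ 'm ^ 'n \<Rightarrow> real ^ 'n" where
  "marginals M X = (\<chi> i. measure_pmf.prob (M X) {S. i \<in> S})"

definition metric_dp :: "nat \<Rightarrow> real \<Rightarrow> (real ^ 'm ^ 'n \<Rightarrow> 'n set pmf) \<Rightarrow> bool" where
  "metric_dp k \<epsilon> M \<longleftrightarrow>
     (\<forall>X\<in>review_matrices. \<forall>X'\<in>review_matrices. \<forall>S. card S = k \<longrightarrow>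
        pmf (M X) S \<le> exp (\<epsilon> * norm11 (X - X')) * pmf (M X') S)"

definition smooth :: "real \<Rightarrow> (real ^ 'm ^ 'n \<Rightarrow> real ^ 'n) \<Rightarrow> bool" where
  "smooth L p \<longleftrightarrow>
     (\<forall>X\<in>review_matrices. \<forall>X'\<in>review_matrices. norm1 (p X - p X') \<le> L * norm11 (X - X'))"

end

theory Submission
  imports Defs
begin

text \<open>
  Pointwise, the privacy bounds \<open>P \<le> exp D * Q\<close> and \<open>Q \<le> exp D * P\<close> give
  \<open>\<bar>P - Q\<bar> \<le> tanh (D / 2) * (P + Q) \<le> D / 2 * (P + Q)\<close>. Since both laws sum to 1, summing over all
  sets bounds the \<open>\<ell>\<^sub>1\<close> distance between them by \<open>D\<close>. Each set of size \<open>k\<close> contributes to exactly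
  \<open>k\<close> marginals, so the marginals differ by at most \<open>k * D\<close>.
\<close>

text \<open>This is \<open>tanh (x / 2) \<le> x / 2\<close> with denominators cleared. The
  difference of the two sides vanishes at 0, and its derivative is nonnegative because
  \<open>1 - t \<le> exp (- t)\<close>.\<close>

lemma exp_mult_one_minus_half_le:
  fixes x :: real
  assumes "0 \<le> x"
  shows "exp x * (1 - x / 2) \<le> 1 + x / 2"
proof -
  let ?f = "\<lambda>t::real. 1 + t / 2 - exp t * (1 - t / 2)"
  have "?f 0 \<le> ?f x"
  proof (rule DERIV_nonneg_imp_nondecreasing[OF assms])
    fix t :: real
    have "(?f has_real_derivative (1 - exp t * (1 - t)) / 2) (at t)"
      by (auto intro!: derivative_eq_intros simp: field_simps)
    moreover have "exp t * (1 - t) \<le> exp t * exp (- t)"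
      using exp_ge_add_one_self[of "- t"] by (intro mult_left_mono) auto
    ultimately show "\<exists>y. (?f has_real_derivative y) (at t) \<and> 0 \<le> y"
      by (intro exI[of _ "(1 - exp t * (1 - t)) / 2"]) (auto simp: exp_minus)
  qed
  then show ?thesis by simp
qed

text \<open>Bounding by \<open>P + Q\<close> keeps the estimate linear in \<open>D\<close>; the
  one-sided \<open>P - Q \<le> (exp D - 1) * Q\<close> would only give an exponential factor after
  summation.\<close>

lemma abs_diff_le_of_exp_ratio:
  fixes P Q D :: real
  assumes "0 \<le> P" "0 \<le> Q" "0 \<le> D" "P \<le> exp D * Q" "Q \<le> exp D * P"
  shows "\<bar>P - Q\<bar> \<le> D / 2 * (P + Q)"
proof -
  \<comment> \<open>This rearranges \<open>a - b \<le> D / 2 * (a + b)\<close>. The hypothesis may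
    be multiplied by \<open>1 - D / 2\<close> only while that factor is nonnegative; for
    \<open>D > 2\<close> the signs of the two sides suffice.\<close>
  have *: "a * (1 - D / 2) \<le> b * (1 + D / 2)"
    if "0 \<le> a" "0 \<le> b" "a \<le> exp D * b" for a b :: real
  proof (cases "D \<le> 2")
    case True
    have "a * (1 - D / 2) \<le> (exp D * b) * (1 - D / 2)"
      using that True by (intro mult_right_mono) auto
    also have "\<dots> = b * (exp D * (1 - D / 2))"
      by simp
    also have "\<dots> \<le> b * (1 + D / 2)"
      using that exp_mult_one_minus_half_le[OF \<open>0 \<le> D\<close>] by (intro mult_left_mono)
    finally show ?thesis .
  next
    case False
    then have "a * (1 - D / 2) \<le> 0"
      using that by (intro mult_nonneg_nonpos) auto
    also have "0 \<le> b * (1 + D / 2)"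
      using that \<open>0 \<le> D\<close> by simp
    finally show ?thesis .
  qed
  from *[of P Q] *[of Q P] assms show ?thesis
    by (intro abs_leI) (simp_all add: field_simps)
qed

lemma norm11_nonneg: "0 \<le> norm11 A"
  unfolding norm11_def by (intro sum_nonneg) auto

lemma norm11_minus_commute: "norm11 (A - B) = norm11 (B - A)"
  unfolding norm11_def by (simp add: abs_minus_commute)

lemma pmf_selection_rule_eq_0:
  assumes "selection_rule k M" "X \<in> review_matrices" "card S \<noteq> k"
  shows "pmf (M X) S = 0"
proof -
  have "S \<notin> set_pmf (M X)"
    using assms unfolding selection_rule_def by blast
  then show ?thesis
    by (simp add: pmf_eq_0_set_pmf)
qed

lemma norm1_marginals_diff_le:
  fixes M :: "real ^ 'm ^ 'n \<Rightarrow> 'n set pmf"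
  assumes "selection_rule k M" "X \<in> review_matrices" "X' \<in> review_matrices"
  shows "norm1 (marginals M X - marginals M X') \<le>
    real k * (\<Sum>S\<in>UNIV. \<bar>pmf (M X) S - pmf (M X') S\<bar>)"
proof -
  let ?d = "\<lambda>S. pmf (M X) S - pmf (M X') S"
  have zero: "?d S = 0" if "card S \<noteq> k" for S
    using pmf_selection_rule_eq_0[OF assms(1)] assms(2,3) that by simp
  have "norm1 (marginals M X - marginals M X') = (\<Sum>i\<in>UNIV. \<bar>\<Sum>S | i \<in> S. ?d S\<bar>)"
    unfolding norm1_def marginals_def by (simp add: measure_measure_pmf_finite sum_subtractf)
  also have "\<dots> \<le> (\<Sum>i\<in>UNIV. \<Sum>S | i \<in> S. \<bar>?d S\<bar>)"
    by (intro sum_mono sum_abs)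
  \<comment> \<open>Double counting of the pairs with \<open>i \<in> S\<close>: each
    \<open>S\<close> now occurs \<open>card S\<close> times, and \<open>card S = k\<close> wherever
    \<open>?d S\<close> is nonzero.\<close>
  also have "\<dots> = (\<Sum>S\<in>UNIV. \<Sum>i\<in>S. \<bar>?d S\<bar>)"
    using sum.swap_restrict[of UNIV UNIV "\<lambda>_ S. \<bar>?d S\<bar>" "\<lambda>i S. i \<in> S"] by simp
  also have "\<dots> = (\<Sum>S\<in>UNIV. real k * \<bar>?d S\<bar>)"
    using zero by (intro sum.cong refl) fastforce
  finally show ?thesis
    by (simp add: sum_distrib_left)
qed

lemma metric_dp_l1_dist_le:
  fixes M :: "real ^ 'm ^ 'n \<Rightarrow> 'n set pmf"
  assumes "0 \<le> \<epsilon>" "selection_rule k M" "metric_dp k \<epsilon> M"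
    and X: "X \<in> review_matrices" "X' \<in> review_matrices"
  shows "(\<Sum>S\<in>UNIV. \<bar>pmf (M X) S - pmf (M X') S\<bar>) \<le> \<epsilon> * norm11 (X - X')"
proof -
  let ?D = "\<epsilon> * norm11 (X - X')"
  \<comment> \<open>Privacy only constrains sets of size \<open>k\<close>; all others have mass 0,
    so the bound extends to every \<open>S\<close> and the sums can run over
    \<open>UNIV\<close>.\<close>
  have le: "pmf (M Y) S \<le> exp (\<epsilon> * norm11 (Y - Y')) * pmf (M Y') S"
    if "Y \<in> review_matrices" "Y' \<in> review_matrices" for Y Y' S
  proof (cases "card S = k")
    case True
    then show ?thesis using assms(3) that unfolding metric_dp_def by blast
  next
    case False
    then show ?thesis
      using pmf_selection_rule_eq_0[OF assms(2) that(1)] by simp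
  qed
  have "(\<Sum>S\<in>UNIV. \<bar>pmf (M X) S - pmf (M X') S\<bar>) \<le>
      (\<Sum>S\<in>UNIV. ?D / 2 * (pmf (M X) S + pmf (M X') S))"
    \<comment> \<open>Privacy is used in both directions; by symmetry of \<open>norm11\<close> both
      have the exponent \<open>?D\<close>.\<close>
    using le[OF X] le[OF X(2,1)] \<open>0 \<le> \<epsilon>\<close>
    by (intro sum_mono abs_diff_le_of_exp_ratio)
      (auto simp: norm11_nonneg norm11_minus_commute[of X'])
  also have "\<dots> = ?D / 2 * ((\<Sum>S\<in>UNIV. pmf (M X) S) + (\<Sum>S\<in>UNIV. pmf (M X') S))"
    by (simp only: sum_distrib_left[symmetric] sum.distrib)
  also have "\<dots> = ?D"
    by (simp add: sum_pmf_eq_1)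
  finally show ?thesis .
qed

theorem proposition3:
  fixes M :: "real ^ 'm ^ 'n \<Rightarrow> 'n set pmf"
    and k :: nat and \<epsilon> :: real
  assumes "1 \<le> k" and "k \<le> CARD('n)"
    and "\<epsilon> \<ge> 0"
    and "selection_rule k M"
    and "metric_dp k \<epsilon> M"
  shows "\<exists>L. L \<le> \<epsilon> * real k \<and> smooth L (marginals M)"
proof -
  have "norm1 (marginals M X - marginals M X') \<le> \<epsilon> * real k * norm11 (X - X')"
    if "X \<in> review_matrices" "X' \<in> review_matrices" for X X'
  proof -
    note norm1_marginals_diff_le[OF assms(4) that]
    also have "real k * (\<Sum>S\<in>UNIV. \<bar>pmf (M X) S - pmf (M X') S\<bar>) \<le> real k * (\<epsilon> * norm11 (X - X'))"
      using metric_dp_l1_dist_le[OF assms(3-5) that] by (intro mult_left_mono) auto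
    finally show ?thesis by (simp add: mult_ac)
  qed
  \<comment> \<open>The witness is \<open>L = \<epsilon> * real k\<close> itself.\<close>
  then show ?thesis
    unfolding smooth_def by blast
qed

end
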